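(* Let $\mathbb{F}_q$ be a finite field with $q$ elements and characteristic $p$, let $n,m,k,r$ be positive integers, and let $r=\sum_{t=0}^{s_r} r_t p^{t}$ be the base-$p$ expansion of $r$ (digits $0\le r_t\le p-1$). Put $$\gamma_{n,p}(r)=\prod_{t=0}^{s_r}\binom{r_t+n-1}{r_t}.$$ Then the neuromanifold satisfies $$|\mathcal{P}_{(n,m,k),r}(\mathbb{F}_q)|\le \left(q^{\gamma_{n,p}(r)}\right)^k .$$
   Context: For a field $\mathbb{F}$ and positive integers $n,r$, $S^r(\mathbb{F}^n)$ denotes the space of homogeneous polynomials of degree $r$ in $x_1,\dots,x_n$ over $\mathbb{F}$ (including $0$). For positive integers $n,m,k,r$, the neuromanifold $\mathcal{P}_{(n,m,k),r}(\mathbb{F})\subseteq (S^r(\mathbb{F}^n))^k$ is the set of all $k$-tuples of polynomials $(f_1,\dots,f_k)$ of the form $$f_i=\sum_{s=1}^m b_{is}(a_{s1}x_1+\dots+a_{sn}x_n)^r,\qquad i=1,\dots,k,$$ with $(a_{sj})\in\mathbb{F}^{m\times n}$ and $(b_{is})\in\mathbb{F}^{k\times m}$ arbitrary. Equality is equality of polynomials, not of functions on $\mathbb{F}^n$. *)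

theory Defs
  imports
    "HOL-Library.Poly_Mapping"
    "HOL-Library.FuncSet"
    "HOL-Library.Cardinality"
    "HOL-Computational_Algebra.Primes"
begin

text \<open>
  A polynomial is a finitely supported map from exponent vectors to coefficients, with the
  convolution product of \<^theory>\<open>HOL-Library.Poly_Mapping\<close>. Equality is thus equality of
  coefficients, not of the induced functions.
\<close>

type_synonym 'a mpoly = "(nat \<Rightarrow>\<^sub>0 nat) \<Rightarrow>\<^sub>0 'a"

definition var :: "nat \<Rightarrow> 'a::field mpoly"
  where "var j = Poly_Mapping.single (Poly_Mapping.single j 1) 1"

definition const :: "'a::field \<Rightarrow> 'a mpoly"
  where "const c = Poly_Mapping.single 0 c"

definition homogeneous_polys :: "nat \<Rightarrow> nat \<Rightarrow> 'a::field mpoly set"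
  where "homogeneous_polys n r =
    {f. \<forall>e\<in>Poly_Mapping.keys f. Poly_Mapping.keys e \<subseteq> {1..n} \<and>
          (\<Sum>j=1..n. Poly_Mapping.lookup e j) = r}"

definition linear_form :: "nat \<Rightarrow> (nat \<Rightarrow> 'a::field) \<Rightarrow> 'a mpoly"
  where "linear_form n c = (\<Sum>j=1..n. const (c j) * var j)"

text \<open>
  Matrices and \<open>k\<close>-tuples are functions on index ranges starting at 1. A \<open>k\<close>-tuple is restricted
  to \<open>{1..k}\<close>, so that two tuples are equal iff their \<open>k\<close> entries agree; entries of \<open>a\<close> and \<open>b\<close>
  outside the ranges \<open>{1..m} \<times> {1..n}\<close> and \<open>{1..k} \<times> {1..m}\<close> have no influence.
\<close>

definition network_tuple ::
  "nat \<Rightarrow> nat \<Rightarrow> nat \<Rightarrow> nat \<Rightarrow> (nat \<Rightarrow> nat \<Rightarrow> 'a::field) \<Rightarrow> (nat \<Rightarrow> nat \<Rightarrow> 'a) \<Rightarrow> nat \<Rightarrow> 'a mpoly"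
  where "network_tuple n m k r a b =
    (\<lambda>i\<in>{1..k}. \<Sum>s=1..m. const (b i s) * linear_form n (a s) ^ r)"

definition neuromanifold :: "nat \<Rightarrow> nat \<Rightarrow> nat \<Rightarrow> nat \<Rightarrow> (nat \<Rightarrow> 'a::field mpoly) set"
  where "neuromanifold n m k r = {network_tuple n m k r a b | a b. True}"

lemma homogeneous_polys_mult:
  assumes "f \<in> homogeneous_polys n r" and "g \<in> homogeneous_polys n s"
  shows "f * g \<in> homogeneous_polys n (r + s)"
proof -
  have "Poly_Mapping.keys e \<subseteq> {1..n} \<and> (\<Sum>j=1..n. Poly_Mapping.lookup e j) = r + s"
    if e: "e \<in> Poly_Mapping.keys (f * g)" for e
  proof -
    obtain u v where uv: "u \<in> Poly_Mapping.keys f" "v \<in> Poly_Mapping.keys g" "e = u + v"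
      using e keys_mult[of f g] by blast
    then show ?thesis
      using assms Poly_Mapping.keys_add[of u v]
      by (fastforce simp: homogeneous_polys_def lookup_add sum.distrib)
  qed
  then show ?thesis by (simp add: homogeneous_polys_def)
qed

lemma homogeneous_polys_sum:
  assumes "\<And>i. i \<in> I \<Longrightarrow> f i \<in> homogeneous_polys n r"
  shows "sum f I \<in> homogeneous_polys n r"
  using assms Poly_Mapping.keys_sum[of f I] by (fastforce simp: homogeneous_polys_def)

lemma const_homogeneous: "const c \<in> homogeneous_polys n 0"
  by (simp add: homogeneous_polys_def const_def)

lemma var_homogeneous: "j \<in> {1..n} \<Longrightarrow> var j \<in> homogeneous_polys n 1"
  by (simp add: homogeneous_polys_def var_def lookup_single when_def)

lemma linear_form_homogeneous: "linear_form n c \<in> homogeneous_polys n 1"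
  unfolding linear_form_def
  using homogeneous_polys_mult[OF const_homogeneous var_homogeneous]
  by (intro homogeneous_polys_sum) simp

lemma linear_form_power_homogeneous: "linear_form n c ^ r \<in> homogeneous_polys n r"
proof (induction r)
  case 0
  then show ?case using const_homogeneous[of 1 n] by (simp add: const_def)
next
  case (Suc r)
  then show ?case using homogeneous_polys_mult[OF linear_form_homogeneous Suc.IH] by simp
qed

lemma neuromanifold_subset:
  "neuromanifold n m k r \<subseteq> {1..k} \<rightarrow>\<^sub>E homogeneous_polys n r"
  using homogeneous_polys_mult[OF const_homogeneous linear_form_power_homogeneous]
  by (auto simp: neuromanifold_def network_tuple_def intro!: homogeneous_polys_sum)

end

theory Submission
  imports Defs "HOL-Library.Set_Algebras" "HOL-Library.Multiset"
begin

text \<open>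
  In characteristic \<open>p\<close> the Frobenius map is additive, so raising a polynomial to the power \<open>p ^ t\<close>
  multiplies its exponent vectors by \<open>p ^ t\<close>. Write \<open>\<ell> ^ r = (\<Prod>t. (\<ell> ^ r\<^sub>t) ^ p ^ t)\<close> for a linear
  form \<open>\<ell>\<close>: every exponent vector of \<open>\<ell> ^ r\<close> has the form \<open>\<Sum>t. p ^ t * u\<^sub>t\<close> with \<open>u\<^sub>t\<close> of degree
  \<open>r\<^sub>t\<close>. There are at most \<open>\<gamma> = (\<Prod>t. (r\<^sub>t + n - 1) choose r\<^sub>t)\<close> such vectors, independently of \<open>\<ell>\<close>,
  and each of the \<open>k\<close> entries of a tuple is a polynomial supported on them.
\<close>

lemma card_set_plus_le:
  assumes "finite A" and "finite B"
  shows "card (A + B) \<le> card A * card B"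
  unfolding set_plus_image card_cartesian_product[symmetric]
  using assms by (intro card_image_le) simp

lemma finite_sum_sets:
  fixes S :: "'i \<Rightarrow> 'b::comm_monoid_add set"
  assumes "\<And>i. i \<in> I \<Longrightarrow> finite (S i)"
  shows "finite (sum S I)"
  using assms by (induction I rule: infinite_finite_induct) (simp_all add: finite_set_plus)

lemma card_sum_sets_le:
  fixes S :: "'i \<Rightarrow> 'b::comm_monoid_add set"
  assumes "\<And>i. i \<in> I \<Longrightarrow> finite (S i)"
  shows "card (sum S I) \<le> (\<Prod>i\<in>I. card (S i))"
  using assms
proof (induction I rule: infinite_finite_induct)
  case (insert i I)
  have "card (sum S (insert i I)) \<le> card (S i) * card (sum S I)"
    using insert.hyps insert.prems by (simp add: card_set_plus_le finite_sum_sets)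
  also have "\<dots> \<le> card (S i) * (\<Prod>i\<in>I. card (S i))"
    using insert.IH insert.prems by simp
  finally show ?case
    using insert.hyps by simp
qed simp_all

definition supported_on :: "'b set \<Rightarrow> ('b \<Rightarrow>\<^sub>0 'a::zero) set"
  where "supported_on E = {f. Poly_Mapping.keys f \<subseteq> E}"

lemma supported_on_sum:
  assumes "\<And>i. i \<in> I \<Longrightarrow> f i \<in> supported_on E"
  shows "sum f I \<in> supported_on E"
  using assms Poly_Mapping.keys_sum[of f I] by (fastforce simp: supported_on_def)

lemma supported_on_mult:
  assumes "f \<in> supported_on E" and "g \<in> supported_on F"
  shows "f * g \<in> supported_on (E + F)"
  using assms keys_mult[of f g] unfolding supported_on_def by blast

lemma supported_on_prod:
  fixes f :: "'i \<Rightarrow> ('b::comm_monoid_add \<Rightarrow>\<^sub>0 'a::comm_semiring_1)"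
  assumes "\<And>i. i \<in> I \<Longrightarrow> f i \<in> supported_on (E i)"
  shows "prod f I \<in> supported_on (sum E I)"
proof -
  have "(1 :: 'b \<Rightarrow>\<^sub>0 'a) \<in> supported_on {0}"
    by (simp add: supported_on_def)
  then show ?thesis
    using assms by (induction I rule: infinite_finite_induct) (simp_all add: supported_on_mult)
qed

lemma bij_betw_lookup_supported_on:
  assumes "finite E"
  shows "bij_betw (\<lambda>f. restrict (Poly_Mapping.lookup f) E)
    (supported_on E :: ('b \<Rightarrow>\<^sub>0 'a::zero) set) (E \<rightarrow>\<^sub>E UNIV)"
proof (rule bij_betw_byWitness)
  let ?zero_ext = "\<lambda>g e. if e \<in> E then g e else 0 :: 'a"
  let ?ext = "\<lambda>g. Abs_poly_mapping (?zero_ext g)"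
  have lookup_ext: "Poly_Mapping.lookup (?ext g) = ?zero_ext g" for g
    using assms by simp
  then have keys_ext: "Poly_Mapping.keys (?ext g) \<subseteq> E" for g
    by (auto simp only: in_keys_iff split: if_splits)
  have restrict_ext: "restrict (?zero_ext g) E = restrict g E" for g
    by (rule restrict_ext) simp
  show "\<forall>f\<in>supported_on E. ?ext (restrict (Poly_Mapping.lookup f) E) = f"
    by (auto simp: supported_on_def lookup_ext in_keys_iff intro!: poly_mapping_eqI)
  show "\<forall>g\<in>E \<rightarrow>\<^sub>E UNIV. restrict (Poly_Mapping.lookup (?ext g)) E = g"
    unfolding lookup_ext restrict_ext using PiE_restrict by blast
  show "?ext ` (E \<rightarrow>\<^sub>E UNIV) \<subseteq> supported_on E"
    using keys_ext unfolding supported_on_def by blast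
qed auto

lemma finite_supported_on:
  assumes "finite E"
  shows "finite (supported_on E :: ('b \<Rightarrow>\<^sub>0 'a::{zero,finite}) set)"
  using bij_betw_finite[OF bij_betw_lookup_supported_on[OF assms, where ?'a = 'a]] assms
  by (simp add: finite_PiE)

lemma card_supported_on:
  assumes "finite E"
  shows "card (supported_on E :: ('b \<Rightarrow>\<^sub>0 'a::{zero,finite}) set) = CARD('a) ^ card E"
  using bij_betw_same_card[OF bij_betw_lookup_supported_on[OF assms, where ?'a = 'a]] assms
  by (simp add: card_PiE)

definition exponents :: "'v set \<Rightarrow> nat \<Rightarrow> ('v \<Rightarrow>\<^sub>0 nat) set"
  where "exponents V d =
    {e. Poly_Mapping.keys e \<subseteq> V \<and> (\<Sum>j\<in>V. Poly_Mapping.lookup e j) = d}"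

lemma homogeneous_polys_eq_supported_on:
  "homogeneous_polys n d = supported_on (exponents {1..n} d)"
  by (auto simp: homogeneous_polys_def supported_on_def exponents_def)

lemma bij_betw_exponents_multisets_of_size:
  fixes V :: "'v set"
  assumes "finite V"
  shows "bij_betw (\<lambda>e. Abs_multiset (Poly_Mapping.lookup e)) (exponents V d) (multisets_of_size V d)"
proof (rule bij_betw_byWitness)
  let ?mset = "\<lambda>e. Abs_multiset (Poly_Mapping.lookup e)"
  let ?exponent = "\<lambda>M. Abs_poly_mapping (count M)"
  have count_mset: "count (?mset e) = Poly_Mapping.lookup e" for e :: "'v \<Rightarrow>\<^sub>0 nat"
    using finite_lookup[of e] by simp
  have lookup_exponent: "Poly_Mapping.lookup (?exponent M) = count M" for M :: "'v multiset"
    by simp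
  have size_eq: "size M = (\<Sum>j\<in>V. count M j)" if "set_mset M \<subseteq> V" for M
    unfolding size_multiset_overloaded_eq
    using assms that by (intro sum.mono_neutral_left) (auto simp: not_in_iff)
  show "\<forall>e\<in>exponents V d. ?exponent (?mset e) = e"
    by (simp add: count_mset)
  show "\<forall>M\<in>multisets_of_size V d. ?mset (?exponent M) = M"
    by (simp add: lookup_exponent count_inverse)
  have "set_mset (?mset e) = Poly_Mapping.keys e" for e :: "'v \<Rightarrow>\<^sub>0 nat"
    by (auto simp: count_mset in_keys_iff simp flip: count_greater_zero_iff)
  then show "?mset ` exponents V d \<subseteq> multisets_of_size V d"
    by (auto simp: exponents_def multisets_of_size_def size_eq count_mset)
  have "Poly_Mapping.keys (?exponent M) = set_mset M" for M :: "'v multiset"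
    by (auto simp: lookup_exponent in_keys_iff)
  then show "?exponent ` multisets_of_size V d \<subseteq> exponents V d"
    by (auto simp: exponents_def multisets_of_size_def lookup_exponent size_eq)
qed

lemma finite_exponents:
  assumes "finite V"
  shows "finite (exponents V d)"
  using bij_betw_finite[OF bij_betw_exponents_multisets_of_size[OF assms]] assms by blast

lemma card_exponents:
  assumes "finite V"
  shows "card (exponents V d) = (d + card V - 1) choose d"
  using bij_betw_same_card[OF bij_betw_exponents_multisets_of_size[OF assms]]
  by (simp add: card_multisets_of_size[OF assms] add.commute)

lemma poly_mapping_eq_sum_single:
  fixes f :: "'b \<Rightarrow>\<^sub>0 'a::comm_monoid_add"
  shows "f = (\<Sum>e\<in>Poly_Mapping.keys f. Poly_Mapping.single e (Poly_Mapping.lookup f e))"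
  by (rule poly_mapping_eqI) (simp add: lookup_sum lookup_single when_def in_keys_iff)

lemma single_power:
  fixes e :: "'b::semiring_1" and a :: "'a::semiring_1"
  shows "Poly_Mapping.single e a ^ N = Poly_Mapping.single (of_nat N * e) (a ^ N)"
  by (induction N) (simp_all add: mult_single distrib_right)

lemma CHAR_poly_mapping: "CHAR('b::monoid_add \<Rightarrow>\<^sub>0 'a::semiring_1) = CHAR('a)"
proof -
  have "(of_nat N :: 'b \<Rightarrow>\<^sub>0 'a) = 0 \<longleftrightarrow> (of_nat N :: 'a) = 0" for N
    unfolding single_of_nat[symmetric] by (metis lookup_single_eq lookup_zero single_zero)
  then show ?thesis
    by (intro CHAR_eqI) (simp_all add: of_nat_eq_0_iff_char_dvd)
qed

text \<open>
  Exponent vectors of type \<open>nat \<Rightarrow>\<^sub>0 nat\<close> themselves form a semiring under convolution, in which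
  multiplication by \<open>of_nat N\<close> is scaling by \<open>N\<close>.
\<close>

lemma supported_on_power_CHAR:
  fixes f :: "'b::semiring_1 \<Rightarrow>\<^sub>0 'a::comm_semiring_1"
  assumes "prime CHAR('a)" and "f \<in> supported_on E"
  shows "f ^ CHAR('a) ^ t \<in> supported_on ((*) (of_nat (CHAR('a) ^ t)) ` E)"
proof -
  let ?N = "CHAR('a) ^ t"
  have "f ^ ?N =
      (\<Sum>e\<in>Poly_Mapping.keys f. Poly_Mapping.single e (Poly_Mapping.lookup f e)) ^ ?N"
    by (simp flip: poly_mapping_eq_sum_single)
  also have "\<dots> = (\<Sum>e\<in>Poly_Mapping.keys f. Poly_Mapping.single e (Poly_Mapping.lookup f e) ^ ?N)"
    using assms(1) by (intro freshmans_dream_sum'[where n = t]) (simp_all add: CHAR_poly_mapping)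
  also have "\<dots> = (\<Sum>e\<in>Poly_Mapping.keys f.
      Poly_Mapping.single (of_nat ?N * e) (Poly_Mapping.lookup f e ^ ?N))"
    by (simp only: single_power)
  also have "\<dots> \<in> supported_on ((*) (of_nat ?N) ` E)"
    using assms(2) by (intro supported_on_sum) (auto simp: supported_on_def)
  finally show ?thesis .
qed

lemma supported_on_power_digits:
  fixes f :: "'b::semiring_1 \<Rightarrow>\<^sub>0 'a::comm_semiring_1"
  assumes "prime CHAR('a)" and "\<And>t. t \<in> T \<Longrightarrow> f ^ d t \<in> supported_on (E t)"
  shows "f ^ (\<Sum>t\<in>T. d t * CHAR('a) ^ t) \<in>
    supported_on (\<Sum>t\<in>T. (*) (of_nat (CHAR('a) ^ t)) ` E t)"
  unfolding power_sum power_mult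
  by (intro supported_on_prod supported_on_power_CHAR assms)

definition digit_exponents :: "'v set \<Rightarrow> nat \<Rightarrow> nat set \<Rightarrow> (nat \<Rightarrow> nat) \<Rightarrow> ('v::monoid_add \<Rightarrow>\<^sub>0 nat) set"
  where "digit_exponents V p T d = (\<Sum>t\<in>T. (*) (of_nat (p ^ t)) ` exponents V (d t))"

lemma finite_digit_exponents:
  assumes "finite V"
  shows "finite (digit_exponents V p T d)"
  unfolding digit_exponents_def using assms by (intro finite_sum_sets) (simp add: finite_exponents)

lemma card_digit_exponents_le:
  assumes "finite V"
  shows "card (digit_exponents V p T d) \<le> (\<Prod>t\<in>T. (d t + card V - 1) choose (d t))"
proof -
  have fin: "finite (exponents V (d t))" for t
    using assms by (rule finite_exponents)
  have "card (digit_exponents V p T d) \<le> (\<Prod>t\<in>T. card ((*) (of_nat (p ^ t)) ` exponents V (d t)))"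
    unfolding digit_exponents_def using fin by (intro card_sum_sets_le) simp
  also have "\<dots> \<le> (\<Prod>t\<in>T. card (exponents V (d t)))"
    using fin by (intro prod_mono) (simp add: card_image_le)
  finally show ?thesis
    by (simp add: card_exponents[OF assms])
qed

lemma linear_form_power_supported_on_digit_exponents:
  fixes c :: "nat \<Rightarrow> 'a::field"
  assumes "prime CHAR('a)"
  shows "linear_form n c ^ (\<Sum>t\<in>T. d t * CHAR('a) ^ t) \<in>
    supported_on (digit_exponents {1..n} CHAR('a) T d)"
  unfolding digit_exponents_def
  using linear_form_power_homogeneous
  by (intro supported_on_power_digits assms) (simp add: homogeneous_polys_eq_supported_on)

lemma neuromanifold_subset_supported_on:
  assumes "\<And>c :: nat \<Rightarrow> 'a::field. linear_form n c ^ r \<in> supported_on E"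
  shows "(neuromanifold n m k r :: (nat \<Rightarrow> 'a mpoly) set) \<subseteq> {1..k} \<rightarrow>\<^sub>E supported_on E"
proof -
  have "const b * linear_form n c ^ r \<in> supported_on E" for b :: 'a and c
    using supported_on_mult[OF _ assms, of "const b" "{0}" c]
    by (simp add: supported_on_def const_def)
  then show ?thesis
    by (auto simp: neuromanifold_def network_tuple_def intro!: supported_on_sum)
qed

theorem proposition2p5:
  fixes n m k r p q s\<^sub>r :: nat and d :: "nat \<Rightarrow> nat"
  assumes "CARD('a::finite_field) = q" and "CHAR('a) = p"
    and "n \<ge> 1" and "m \<ge> 1" and "k \<ge> 1" and "r \<ge> 1"
    and "\<forall>t\<in>{0..s\<^sub>r}. d t \<le> p - 1"
    and "r = (\<Sum>t=0..s\<^sub>r. d t * p ^ t)"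
  shows "finite (neuromanifold n m k r :: (nat \<Rightarrow> 'a mpoly) set) \<and>
    card (neuromanifold n m k r :: (nat \<Rightarrow> 'a mpoly) set)
      \<le> (q ^ (\<Prod>t=0..s\<^sub>r. (d t + n - 1) choose (d t))) ^ k"
proof -
  define E where "E = digit_exponents {1..n} p {0..s\<^sub>r} d"
  let ?P = "supported_on E :: 'a mpoly set"
  have fin_E: "finite E"
    unfolding E_def by (simp add: finite_digit_exponents)
  have sub: "neuromanifold n m k r \<subseteq> {1..k} \<rightarrow>\<^sub>E ?P"
    using linear_form_power_supported_on_digit_exponents[where ?'a = 'a] assms(2,8)
    by (intro neuromanifold_subset_supported_on) (auto simp: E_def)
  have fin: "finite ({1..k} \<rightarrow>\<^sub>E ?P)"
    by (intro finite_PiE finite_supported_on fin_E) simp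
  have "card (neuromanifold n m k r :: (nat \<Rightarrow> 'a mpoly) set) \<le> card ({1..k} \<rightarrow>\<^sub>E ?P)"
    using fin sub by (rule card_mono)
  also have "\<dots> = (q ^ card E) ^ k"
    by (simp add: card_PiE card_supported_on[OF fin_E] assms(1))
  also have "\<dots> \<le> (q ^ (\<Prod>t=0..s\<^sub>r. (d t + n - 1) choose (d t))) ^ k"
    using card_digit_exponents_le[of "{1..n}" p "{0..s\<^sub>r}" d] assms(1)
    unfolding E_def by (intro power_mono power_increasing) (auto simp: Suc_le_eq)
  finally show ?thesis
    using finite_subset[OF sub fin] by blast
qed

end
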